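(* Let $T\in\mathbb{C}^{m\times n}$ be a partial isometry and let $A\in\mathbb{C}^{m\times n}$ with $\operatorname{rank}(A)=r$. Then the following are equivalent: (i) $A$ is $T$-EP; (ii) there exist a nonsingular matrix $D\in\mathbb{C}^{r\times r}$ and unitary matrices $U\in\mathbb{C}^{m\times m}$ and $V\in\mathbb{C}^{n\times n}$ such that $$A=U\begin{bmatrix} D & 0\\ 0 & 0\end{bmatrix}U^*T\quad\text{and}\quad T=U\begin{bmatrix} T_1 & 0\\ 0 & T_4\end{bmatrix}V^*,$$ where $T_1\in\mathbb{C}^{r\times r}$ and $T_4\in\mathbb{C}^{(m-r)\times(n-r)}$ are matrices satisfying $T_1T_1^*=I_r$ and $T_4T_4^*T_4=T_4$; (iii) there exists an EP matrix $E\in\mathbb{C}^{m\times m}$ such that $A=ET$ and $TT^*E=E$.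
   Context: $\mathcal{R}(\cdot)$ denotes the range space and $^*$ the conjugate transpose. A matrix $T\in\mathbb{C}^{m\times n}$ is a partial isometry if $T=TT^*T$. A square matrix $E$ is EP if $\mathcal{R}(E)=\mathcal{R}(E^* )$. Given a partial isometry $T\in\mathbb{C}^{m\times n}$, a matrix $A\in\mathbb{C}^{m\times n}$ is $T$-EP if $\mathcal{R}(A)=\mathcal{R}(TA^*T)$ and $A=AT^*T$. In (ii) the middle matrix in the expression for $A$ is $m\times m$. *)

theory Defs
  imports "Jordan_Normal_Form.DL_Rank" "Jordan_Normal_Form.Schur_Decomposition"
begin

notation mat_adjoint (\<open>(_\<^sup>\<dagger>)\<close> [1000] 999)

abbreviation mat_range :: "complex mat \<Rightarrow> complex vec set" where
  "mat_range A \<equiv> vec_space.col_space (dim_row A) A"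

abbreviation mat_rank :: "complex mat \<Rightarrow> nat" where
  "mat_rank A \<equiv> vec_space.rank (dim_row A) A"

definition unitary_mat :: "complex mat \<Rightarrow> bool" where
  "unitary_mat U \<longleftrightarrow>
    square_mat U \<and> U * U\<^sup>\<dagger> = 1\<^sub>m (dim_row U) \<and> U\<^sup>\<dagger> * U = 1\<^sub>m (dim_row U)"

definition partial_isometry :: "complex mat \<Rightarrow> bool" where
  "partial_isometry T \<longleftrightarrow> T = T * T\<^sup>\<dagger> * T"

definition EP_mat :: "complex mat \<Rightarrow> bool" where
  "EP_mat E \<longleftrightarrow> square_mat E \<and> mat_range E = mat_range (E\<^sup>\<dagger>)"

definition T_EP :: "complex mat \<Rightarrow> complex mat \<Rightarrow> bool" where
  "T_EP T A \<longleftrightarrow>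
    partial_isometry T \<and> A \<in> carrier_mat (dim_row T) (dim_col T) \<and>
    mat_range A = mat_range (T * A\<^sup>\<dagger> * T) \<and> A = A * T\<^sup>\<dagger> * T"

end

theory Submission
  imports Defs
begin

text \<open>Everything goes through the EP matrix \<open>E\<close> with \<open>A = E T\<close> and \<open>T T\<^sup>\<dagger> E = E\<close>. If \<open>A\<close> is
\<open>T\<close>-EP, then \<open>E = A T\<^sup>\<dagger>\<close> is one: \<open>A = A T\<^sup>\<dagger> T\<close> gives \<open>E T = A\<close>, and the ranges of \<open>E\<close> and
\<open>E\<^sup>\<dagger> = T A\<^sup>\<dagger>\<close> coincide with those of \<open>A\<close> and \<open>T A\<^sup>\<dagger> T\<close>, which are equal by hypothesis
(\<open>T_EP_imp_EP_factor\<close>). The same computation read backwards gives the converse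
(\<open>EP_factor_imp_T_EP\<close>), because for an EP matrix the projection \<open>T T\<^sup>\<dagger>\<close> fixes \<open>E\<close> if and only
if it fixes \<open>E\<^sup>\<dagger>\<close>.

The block form is what such a factorisation looks like in adapted orthonormal bases. An EP matrix
acts invertibly on its range, a space of dimension \<open>r\<close>, and vanishes on the orthogonal complement.
That range lies in the range of the partial isometry \<open>T\<close>, hence is the isometric image under \<open>T\<close>
of a subspace of dimension \<open>r\<close>, and \<open>T\<close> maps the complement of this subspace into the complement of
the range of \<open>E\<close>. Orthonormal bases of the two subspaces, completed to bases of the whole spaces,
therefore put \<open>E\<close> and \<open>T\<close> simultaneously into block diagonal form, even with \<open>T1\<close> the identity
(\<open>EP_factor_imp_block_form\<close>). Conversely, the block form makes \<open>E = U diag(D, 0) U\<^sup>\<dagger>\<close> an EP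
matrix that is fixed by \<open>T T\<^sup>\<dagger>\<close> (\<open>unitary_block_EP\<close>, \<open>block_range_fixed\<close>).

An orthonormal family is a matrix \<open>X\<close> with \<open>X\<^sup>\<dagger> X = I\<close>. Its existence for a given range and its
completion to a unitary matrix both come from one maximality argument
(\<open>orthonormal_columns_spanning_range\<close>), applied to \<open>E\<close> and to the projection \<open>I - X X\<^sup>\<dagger>\<close>.\<close>

section \<open>Products and conjugate transposes\<close>

text \<open>The premises speak of dimensions rather than of carriers, so that the simplifier can
reassociate long products: it computes the dimensions of every factor, whereas the inner
dimensions of a carrier premise would have to be guessed.\<close>

lemma mat_mult_assoc:
  fixes A B C :: "'a::semiring_0 mat"
  assumes "dim_col A = dim_row B" "dim_col B = dim_row C"
  shows "(A * B) * C = A * (B * C)"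
  by (rule assoc_mult_mat[of _ "dim_row A" "dim_row B" _ "dim_row C" _ "dim_col C"]) (use assms in auto)

lemma dim_adjoint [simp]:
  "dim_row (A\<^sup>\<dagger>) = dim_col A" "dim_col (A\<^sup>\<dagger>) = dim_row A"
  by (simp_all add: mat_adjoint_def)

lemma adjoint_carrier [simp]: "A \<in> carrier_mat m n \<Longrightarrow> A\<^sup>\<dagger> \<in> carrier_mat n m"
  by (rule carrier_matI) simp_all

lemma index_adjoint [simp]:
  assumes "i < dim_col A" "j < dim_row A"
  shows "(A\<^sup>\<dagger>) $$ (i, j) = conjugate (A $$ (j, i))"
  using assms by (simp add: mat_adjoint_def mat_of_rows_def)

lemma adjoint_adjoint [simp]: "(A\<^sup>\<dagger>)\<^sup>\<dagger> = A"
  by (rule eq_matI) auto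

lemma adjoint_mult:
  assumes "dim_col A = dim_row B"
  shows "(A * B)\<^sup>\<dagger> = B\<^sup>\<dagger> * A\<^sup>\<dagger>"
proof (rule eq_matI)
  fix i j assume "i < dim_row (B\<^sup>\<dagger> * A\<^sup>\<dagger>)" "j < dim_col (B\<^sup>\<dagger> * A\<^sup>\<dagger>)"
  then show "((A * B)\<^sup>\<dagger>) $$ (i, j) = (B\<^sup>\<dagger> * A\<^sup>\<dagger>) $$ (i, j)"
    using assms by (simp add: scalar_prod_def sum_conjugate conjugate_dist_mul mult.commute)
qed auto

lemma adjoint_one [simp]: "(1\<^sub>m n)\<^sup>\<dagger> = (1\<^sub>m n :: complex mat)"
  by (rule eq_matI) auto

lemma adjoint_zero [simp]: "(0\<^sub>m m n)\<^sup>\<dagger> = (0\<^sub>m n m :: complex mat)"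
  by (rule eq_matI) auto

lemma adjoint_four_block:
  fixes A B C D :: "complex mat"
  assumes "A \<in> carrier_mat m1 n1" "B \<in> carrier_mat m1 n2"
    "C \<in> carrier_mat m2 n1" "D \<in> carrier_mat m2 n2"
  shows "(four_block_mat A B C D)\<^sup>\<dagger> = four_block_mat (A\<^sup>\<dagger>) (C\<^sup>\<dagger>) (B\<^sup>\<dagger>) (D\<^sup>\<dagger>)"
  by (rule eq_matI) (use assms in auto)

lemma adjoint_minus:
  fixes A B :: "complex mat"
  assumes "dim_row A = dim_row B" "dim_col A = dim_col B"
  shows "(A - B)\<^sup>\<dagger> = A\<^sup>\<dagger> - B\<^sup>\<dagger>"
  by (rule eq_matI) (use assms in auto)

section \<open>Range and rank\<close>

text \<open>Inclusion of ranges is solvability of a matrix equation: solve for one column at a time.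
In this form every statement about ranges below becomes an identity between products.\<close>

lemma range_subset_iff_factor:
  assumes A: "A \<in> carrier_mat m n" and B: "B \<in> carrier_mat m k"
  shows "mat_range A \<subseteq> mat_range B \<longleftrightarrow> (\<exists>Y \<in> carrier_mat k n. A = B * Y)"
proof -
  have rA: "mat_range A = {y \<in> carrier_vec m. \<exists>x \<in> carrier_vec n. A *\<^sub>v x = y}"
    and rB: "mat_range B = {y \<in> carrier_vec m. \<exists>x \<in> carrier_vec k. B *\<^sub>v x = y}"
    using A B by (auto simp: vec_space.col_space_eq)
  show ?thesis
  proof
    assume sub: "mat_range A \<subseteq> mat_range B"
    have "\<exists>y. y \<in> carrier_vec k \<and> B *\<^sub>v y = col A j" if "j < n" for j
    proof -
      have "A *\<^sub>v unit_vec n j = col A j"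
        using A that by (intro eq_vecI) auto
      moreover have "A *\<^sub>v unit_vec n j \<in> mat_range A"
        unfolding rA using A that by auto
      ultimately show ?thesis using sub unfolding rB by auto
    qed
    then have "\<exists>y. \<forall>j. j < n \<longrightarrow> y j \<in> carrier_vec k \<and> B *\<^sub>v y j = col A j"
      by (intro choice) blast
    then obtain y where yB: "\<forall>j. j < n \<longrightarrow> y j \<in> carrier_vec k \<and> B *\<^sub>v y j = col A j" ..
    have y: "y j \<in> carrier_vec k" and By: "B *\<^sub>v y j = col A j" if "j < n" for j
      using yB that by blast+
    define Y where "Y = mat_of_cols k (map y [0..<n])"
    have Y: "Y \<in> carrier_mat k n" unfolding Y_def by (rule carrier_matI) simp_all
    have "A = B * Y"
    proof (rule eq_matI)
      fix i j assume "i < dim_row (B * Y)" and "j < dim_col (B * Y)"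
      then have ij: "i < m" "j < n" using B Y by auto
      then have "A $$ (i, j) = (B *\<^sub>v y j) $ i" using A By by simp
      also have "\<dots> = row B i \<bullet> y j" using ij B by simp
      also have "y j = col Y j" using ij y by (simp add: Y_def)
      also have "row B i \<bullet> col Y j = (B * Y) $$ (i, j)" using ij B Y by simp
      finally show "A $$ (i, j) = (B * Y) $$ (i, j)" .
    qed (use A B Y in auto)
    with Y show "\<exists>Y \<in> carrier_mat k n. A = B * Y" by blast
  next
    assume "\<exists>Y \<in> carrier_mat k n. A = B * Y"
    then obtain Y where Y: "Y \<in> carrier_mat k n" and ABY: "A = B * Y" by blast
    show "mat_range A \<subseteq> mat_range B"
    proof
      fix v assume "v \<in> mat_range A"
      then obtain x where v: "v \<in> carrier_vec m" and x: "x \<in> carrier_vec n" "A *\<^sub>v x = v"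
        unfolding rA by blast
      have "B *\<^sub>v (Y *\<^sub>v x) = v"
        using assoc_mult_mat_vec[OF B Y x(1)] x(2) unfolding ABY by simp
      moreover have "Y *\<^sub>v x \<in> carrier_vec k" using Y x(1) by simp
      ultimately show "v \<in> mat_range B" unfolding rB using v by blast
    qed
  qed
qed

lemma range_eqI:
  assumes "A \<in> carrier_mat m n" "B \<in> carrier_mat m k"
    and "Y \<in> carrier_mat k n" "A = B * Y" and "Z \<in> carrier_mat n k" "B = A * Z"
  shows "mat_range A = mat_range B"
  using assms(3-6) range_subset_iff_factor[OF assms(1,2)] range_subset_iff_factor[OF assms(2,1)]
  by blast

lemma factor_of_range_subset:
  assumes "A \<in> carrier_mat m n" "B \<in> carrier_mat m k" "mat_range A \<subseteq> mat_range B"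
  obtains Y where "Y \<in> carrier_mat k n" "A = B * Y"
  using assms range_subset_iff_factor[OF assms(1,2)] by blast

lemma rank_cong_range:
  assumes "dim_row A = dim_row B" "mat_range A = mat_range B"
  shows "mat_rank A = mat_rank B"
  using assms by (simp add: vec_space.rank_def vec_space.col_space_def)

text \<open>A left inverse makes the columns distinct and linearly independent, because a vanishing
combination of them is recovered as zero.\<close>

lemma rank_left_invertible:
  assumes X: "X \<in> carrier_mat m k" and L: "L \<in> carrier_mat k m" and LX: "L * X = 1\<^sub>m k"
  shows "mat_rank X = k"
proof -
  have dist: "distinct (cols X)"
  proof (rule ccontr)
    assume "\<not> distinct (cols X)"
    then obtain i j where ij: "i < k" "j < k" "i \<noteq> j" "col X i = col X j"
      using X by (auto simp: distinct_conv_nth)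
    then have "(L * X) $$ (i, i) = (L * X) $$ (i, j)" using X L by simp
    then show False unfolding LX using ij by simp
  qed
  have "module.lin_indpt class_ring (module_vec TYPE(complex) m) (set (cols X))"
  proof (rule notI)
    assume "module.lin_dep class_ring (module_vec TYPE(complex) m) (set (cols X))"
    then obtain v where v: "v \<in> carrier_vec k" "v \<noteq> 0\<^sub>v k" "X *\<^sub>v v = 0\<^sub>v m"
      using vec_space.lin_depE[OF X _ dist] by blast
    have "v = (L * X) *\<^sub>v v" using LX v by simp
    also have "\<dots> = L *\<^sub>v (X *\<^sub>v v)" using X L v by simp
    also have "\<dots> = 0\<^sub>v k" using L v by auto
    finally show False using v by simp
  qed
  then show ?thesis using vec_space.lin_indpt_full_rank[OF X dist] X by simp
qed

text \<open>If \<open>k < m\<close>, pad both factors with zeros to square matrices. A one-sided inverse of a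
square matrix is two-sided, yet the product in the other order has a zero last row.\<close>

lemma right_inverse_imp_dim_le:
  fixes A B :: "complex mat"
  assumes A: "A \<in> carrier_mat m k" and B: "B \<in> carrier_mat k m" and AB: "A * B = 1\<^sub>m m"
  shows "m \<le> k"
proof (rule ccontr)
  assume "\<not> m \<le> k"
  then have km: "k + (m - k) = m" "k < m" by auto
  define A' where "A' = four_block_mat A (0\<^sub>m m (m - k)) (0\<^sub>m 0 k) (0\<^sub>m 0 (m - k))"
  define B' where "B' = four_block_mat B (0\<^sub>m k 0) (0\<^sub>m (m - k) m) (0\<^sub>m (m - k) 0)"
  have carr: "A' \<in> carrier_mat m m" "B' \<in> carrier_mat m m"
    using A B km unfolding A'_def B'_def carrier_mat_def by auto
  have "A' * B' = four_block_mat (A * B) (0\<^sub>m m 0) (0\<^sub>m 0 m) (0\<^sub>m 0 0)"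
    unfolding A'_def B'_def using A B
    by (subst mult_four_block_mat) (auto simp: AB)
  also have "\<dots> = 1\<^sub>m m" unfolding AB by (rule eq_matI) auto
  finally have BA: "B' * A' = 1\<^sub>m m" using mat_mult_left_right_inverse carr by blast
  have "row B' (m - 1) = 0\<^sub>v m"
    unfolding B'_def using B km by (intro eq_vecI) auto
  moreover have "col A' (m - 1) \<in> carrier_vec m" using carr by auto
  ultimately have "(B' * A') $$ (m - 1, m - 1) = 0" using carr km by simp
  then show False unfolding BA using km by simp
qed

section \<open>Matrices with orthonormal columns\<close>

text \<open>Side-by-side concatenation is a block matrix with an empty second block row, which lets the
rules for block products be reused.\<close>

definition hcat :: "complex mat \<Rightarrow> complex mat \<Rightarrow> complex mat" where
  "hcat A B = four_block_mat A B (0\<^sub>m 0 (dim_col A)) (0\<^sub>m 0 (dim_col B))"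

lemma hcat_carrier [simp]:
  assumes "A \<in> carrier_mat m k" "B \<in> carrier_mat m l"
  shows "hcat A B \<in> carrier_mat m (k + l)"
  by (rule carrier_matI) (use assms in \<open>simp_all add: hcat_def\<close>)

lemma four_block_no_rows_no_cols:
  "M \<in> carrier_mat m n \<Longrightarrow> four_block_mat M (0\<^sub>m m 0) (0\<^sub>m 0 n) (0\<^sub>m 0 0) = M"
  by (rule eq_matI) auto

lemma mult_hcat:
  assumes "M \<in> carrier_mat p m" "A \<in> carrier_mat m k" "B \<in> carrier_mat m l"
  shows "M * hcat A B = hcat (M * A) (M * B)"
proof -
  have "four_block_mat M (0\<^sub>m p 0) (0\<^sub>m 0 m) (0\<^sub>m 0 0) * hcat A B = hcat (M * A) (M * B)"
    unfolding hcat_def using assms by (subst mult_four_block_mat) auto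
  then show ?thesis using assms by (simp add: four_block_no_rows_no_cols)
qed

lemma hcat_mult_four_block:
  assumes "A \<in> carrier_mat m k" "B \<in> carrier_mat m l"
    and "P \<in> carrier_mat k p" "Q \<in> carrier_mat k q" "R \<in> carrier_mat l p" "S \<in> carrier_mat l q"
  shows "hcat A B * four_block_mat P Q R S = hcat (A * P + B * R) (A * Q + B * S)"
  unfolding hcat_def using assms by (subst mult_four_block_mat) auto

lemma adjoint_hcat:
  assumes "A \<in> carrier_mat m k" "B \<in> carrier_mat m l"
  shows "(hcat A B)\<^sup>\<dagger> = four_block_mat (A\<^sup>\<dagger>) (0\<^sub>m k 0) (B\<^sup>\<dagger>) (0\<^sub>m l 0)"
  unfolding hcat_def using assms by (subst adjoint_four_block) auto

lemma adjoint_hcat_mult_hcat: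
  assumes "A \<in> carrier_mat m k" "B \<in> carrier_mat m l" "C \<in> carrier_mat m p" "D \<in> carrier_mat m q"
  shows "(hcat A B)\<^sup>\<dagger> * hcat C D = four_block_mat (A\<^sup>\<dagger> * C) (A\<^sup>\<dagger> * D) (B\<^sup>\<dagger> * C) (B\<^sup>\<dagger> * D)"
  unfolding adjoint_hcat[OF assms(1,2)] unfolding hcat_def using assms
  by (subst mult_four_block_mat[of _ k m _ 0 _ l _ _ p _ q]) (auto simp: right_add_zero_mat[of _ k p]
    right_add_zero_mat[of _ k q] right_add_zero_mat[of _ l p] right_add_zero_mat[of _ l q])

lemma hcat_mult_adjoint_hcat:
  assumes "A \<in> carrier_mat m k" "B \<in> carrier_mat m l" "C \<in> carrier_mat n k" "D \<in> carrier_mat n l"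
  shows "hcat A B * (hcat C D)\<^sup>\<dagger> = A * C\<^sup>\<dagger> + B * D\<^sup>\<dagger>"
proof -
  have "hcat A B * (hcat C D)\<^sup>\<dagger>
      = four_block_mat (A * C\<^sup>\<dagger> + B * D\<^sup>\<dagger>) (0\<^sub>m m 0) (0\<^sub>m 0 n) (0\<^sub>m 0 0)"
    unfolding adjoint_hcat[OF assms(3,4)] unfolding hcat_def using assms
    by (subst mult_four_block_mat[of _ m k _ l _ 0 _ _ n _ 0]) auto
  also have "\<dots> = A * C\<^sup>\<dagger> + B * D\<^sup>\<dagger>"
    by (rule four_block_no_rows_no_cols) (rule carrier_matI, use assms in simp_all)
  finally show ?thesis .
qed

lemma normalise_column:
  assumes v: "v \<in> carrier_mat m 1" and i: "i < m" and nz: "v $$ (i, 0) \<noteq> 0"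
  obtains c :: complex where "(c \<cdot>\<^sub>m v)\<^sup>\<dagger> * (c \<cdot>\<^sub>m v) = 1\<^sub>m 1"
proof -
  define s where "s = (\<Sum>i<m. (cmod (v $$ (i, 0)))\<^sup>2)"
  have s: "s > 0" unfolding s_def
    by (rule sum_pos2[of _ i]) (use i nz in auto)
  define c where "c = complex_of_real (1 / sqrt s)"
  have "((c \<cdot>\<^sub>m v)\<^sup>\<dagger> * (c \<cdot>\<^sub>m v)) $$ (0, 0)
      = (\<Sum>i<m. cnj (c * v $$ (i, 0)) * (c * v $$ (i, 0)))"
    using v by (simp add: scalar_prod_def lessThan_atLeast0)
  also have "\<dots> = (\<Sum>i<m. (c * c) * complex_of_real ((cmod (v $$ (i, 0)))\<^sup>2))"
    by (rule sum.cong) (simp_all add: complex_norm_square c_def del: of_real_power)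
  also have "\<dots> = (c * c) * complex_of_real s"
    unfolding s_def by (simp add: sum_distrib_left)
  also have "\<dots> = complex_of_real (1 / sqrt s * (1 / sqrt s) * s)"
    by (simp only: c_def of_real_mult)
  also have "1 / sqrt s * (1 / sqrt s) * s = 1"
    using s by (simp add: field_simps)
  finally have "(c \<cdot>\<^sub>m v)\<^sup>\<dagger> * (c \<cdot>\<^sub>m v) = 1\<^sub>m 1"
    using v by (intro eq_matI) auto
  then show ?thesis by (rule that)
qed

text \<open>An orthonormal basis of the range of \<open>E\<close> consists of the columns of \<open>X\<close>; the equations
\<open>X = E Y\<close> and \<open>X X\<^sup>\<dagger> E = E\<close> are the two inclusions between the ranges. Take a matrix
of the form \<open>X = E Y\<close> with orthonormal columns and as many of them as possible. Were
\<open>E - X X\<^sup>\<dagger> E\<close> nonzero, one of its nonzero columns, normalised, would be orthogonal to all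
columns of \<open>X\<close> and again lie in the range of \<open>E\<close>, so that it could be appended.\<close>

lemma orthonormal_columns_spanning_range:
  fixes E :: "complex mat"
  assumes E: "E \<in> carrier_mat m p"
  obtains k X Y where "X \<in> carrier_mat m k" "Y \<in> carrier_mat p k"
    "X\<^sup>\<dagger> * X = 1\<^sub>m k" "X = E * Y" "X * (X\<^sup>\<dagger> * E) = E"
proof -
  define P where "P k \<longleftrightarrow> (\<exists>Y \<in> carrier_mat p k. (E * Y)\<^sup>\<dagger> * (E * Y) = 1\<^sub>m k)" for k
  have "P 0" unfolding P_def using E by (intro bexI[of _ "0\<^sub>m p 0"]) auto
  have bound: "k \<le> m" if "P k" for k
  proof -
    from that obtain Y where "Y \<in> carrier_mat p k" "(E * Y)\<^sup>\<dagger> * (E * Y) = 1\<^sub>m k"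
      unfolding P_def by blast
    then show ?thesis using E by (intro right_inverse_imp_dim_le[of "(E * Y)\<^sup>\<dagger>" _ _ "E * Y"]) auto
  qed
  define k where "k = (GREATEST k. P k)"
  have "P k" unfolding k_def using \<open>P 0\<close> bound by (rule GreatestI_nat)
  have max: "\<not> P (k + 1)"
    using Greatest_le_nat[of P "k + 1" m] bound unfolding k_def by auto
  from \<open>P k\<close> obtain Y where Y: "Y \<in> carrier_mat p k"
    and orth: "(E * Y)\<^sup>\<dagger> * (E * Y) = 1\<^sub>m k"
    unfolding P_def by blast
  define X where "X = E * Y"
  have X: "X \<in> carrier_mat m k" using E Y by (simp add: X_def)
  have XX: "X\<^sup>\<dagger> * X = 1\<^sub>m k" using orth by (simp add: X_def)
  have "X * (X\<^sup>\<dagger> * E) = E"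
  proof (rule ccontr)
    assume neq: "X * (X\<^sup>\<dagger> * E) \<noteq> E"
    \<comment> \<open>A nonzero column \<open>v\<close> of \<open>R\<close> will be a new direction in the range of \<open>E\<close>, orthogonal to \<open>X\<close>.\<close>
    define R where "R = E - X * (X\<^sup>\<dagger> * E)"
    have R: "R \<in> carrier_mat m p" unfolding R_def using E X by auto
    have "\<exists>i j. i < m \<and> j < p \<and> R $$ (i, j) \<noteq> 0"
    proof (rule ccontr)
      assume "\<not> ?thesis"
      then have "X * (X\<^sup>\<dagger> * E) = E"
        unfolding R_def using E X by (intro eq_matI) auto
      with neq show False by contradiction
    qed
    then obtain i j where ij: "i < m" "j < p" "R $$ (i, j) \<noteq> 0" by blast
    define e :: "complex mat" where "e = mat_of_cols p [unit_vec p j]"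
    have e: "e \<in> carrier_mat p 1" unfolding e_def by (rule carrier_matI) simp_all
    define v where "v = R * e"
    have v: "v \<in> carrier_mat m 1" using R e by (simp add: v_def)
    have "col e 0 = unit_vec p j" by (simp add: e_def)
    then have vi: "v $$ (i, 0) \<noteq> 0" using R e ij by (simp add: v_def)
    have Xv: "X\<^sup>\<dagger> * v = 0\<^sub>m k 1"
    proof -
      have "X\<^sup>\<dagger> * R = X\<^sup>\<dagger> * E - X\<^sup>\<dagger> * (X * (X\<^sup>\<dagger> * E))"
        unfolding R_def using E X by (intro mult_minus_distrib_mat) auto
      also have "X\<^sup>\<dagger> * (X * (X\<^sup>\<dagger> * E)) = X\<^sup>\<dagger> * E"
        using E X XX by (simp flip: mat_mult_assoc)
      also have "X\<^sup>\<dagger> * E - X\<^sup>\<dagger> * E = 0\<^sub>m k p" using E X by (intro eq_matI) auto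
      finally have "X\<^sup>\<dagger> * R = 0\<^sub>m k p" .
      then show ?thesis using R X e by (simp add: v_def flip: mat_mult_assoc)
    qed
    \<comment> \<open>\<open>R = E G\<close> shows that \<open>v\<close> lies in the range of \<open>E\<close>.\<close>
    define G where "G = 1\<^sub>m p - Y * (X\<^sup>\<dagger> * E)"
    have G: "G \<in> carrier_mat p p" unfolding G_def using E X Y by auto
    have "R = E * G"
      unfolding R_def G_def using E X Y
      by (subst mult_minus_distrib_mat[of _ m p _ p]) (auto simp: X_def mat_mult_assoc)
    then have vE: "v = E * (G * e)" unfolding v_def using E G e by (simp add: mat_mult_assoc)
    obtain c where c: "(c \<cdot>\<^sub>m v)\<^sup>\<dagger> * (c \<cdot>\<^sub>m v) = 1\<^sub>m 1"
      using normalise_column[OF v ij(1) vi] .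
    have "E * hcat Y (c \<cdot>\<^sub>m (G * e)) = hcat X (c \<cdot>\<^sub>m v)"
      using E Y G e mult_smult_distrib[of E m p "G * e" 1 c]
      by (subst mult_hcat[of _ m p _ k _ 1]) (auto simp: X_def vE)
    moreover have "(hcat X (c \<cdot>\<^sub>m v))\<^sup>\<dagger> * hcat X (c \<cdot>\<^sub>m v) = 1\<^sub>m (k + 1)"
    proof -
      have Xcv: "X\<^sup>\<dagger> * (c \<cdot>\<^sub>m v) = 0\<^sub>m k 1"
        using mult_smult_distrib[of "X\<^sup>\<dagger>" k m v 1 c] X v Xv by (auto intro!: eq_matI)
      then have "(X\<^sup>\<dagger> * (c \<cdot>\<^sub>m v))\<^sup>\<dagger> = (c \<cdot>\<^sub>m v)\<^sup>\<dagger> * X"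
        using X v by (subst adjoint_mult) auto
      then have "(c \<cdot>\<^sub>m v)\<^sup>\<dagger> * X = 0\<^sub>m 1 k" unfolding Xcv by simp
      then show ?thesis
        using X v Xcv XX c by (simp add: adjoint_hcat_mult_hcat[of _ m k _ 1 _ k _ 1])
    qed
    moreover have "hcat Y (c \<cdot>\<^sub>m (G * e)) \<in> carrier_mat p (k + 1)"
      using Y G e by (intro hcat_carrier) simp_all
    ultimately have "P (k + 1)" unfolding P_def by metis
    with max show False by contradiction
  qed
  then show ?thesis using that[OF X Y XX X_def] by blast
qed

lemma orthonormal_range_basis:
  fixes E :: "complex mat"
  assumes E: "E \<in> carrier_mat m p"
  obtains X Y where "X \<in> carrier_mat m (mat_rank E)" "Y \<in> carrier_mat p (mat_rank E)"
    "X\<^sup>\<dagger> * X = 1\<^sub>m (mat_rank E)" "X = E * Y" "X * (X\<^sup>\<dagger> * E) = E"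
proof -
  obtain k X Y where X: "X \<in> carrier_mat m k" and Y: "Y \<in> carrier_mat p k"
    and XX: "X\<^sup>\<dagger> * X = 1\<^sub>m k" and XEY: "X = E * Y" and XXE: "X * (X\<^sup>\<dagger> * E) = E"
    using orthonormal_columns_spanning_range[OF E] .
  have "mat_range E = mat_range X"
    by (rule range_eqI[of _ m p _ k "X\<^sup>\<dagger> * E" Y]) (use E X Y XEY XXE in auto)
  then have "mat_rank E = mat_rank X" using E X by (intro rank_cong_range) auto
  also have "\<dots> = k" using X XX by (intro rank_left_invertible[of _ m _ "X\<^sup>\<dagger>"]) auto
  finally have k: "k = mat_rank E" by simp
  show ?thesis using X Y XX XEY XXE unfolding k by (rule that)
qed

lemma rank_le_dim_row: "mat_rank A \<le> dim_row A"
proof -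
  obtain X Y where X: "X \<in> carrier_mat (dim_row A) (mat_rank A)"
    and "Y \<in> carrier_mat (dim_col A) (mat_rank A)"
    and XX: "X\<^sup>\<dagger> * X = 1\<^sub>m (mat_rank A)" and "X = A * Y" and "X * (X\<^sup>\<dagger> * A) = A"
    using orthonormal_range_basis[OF carrier_matI[OF refl refl]] .
  then show ?thesis by (intro right_inverse_imp_dim_le[OF _ X XX]) simp
qed

text \<open>The columns to be added form an orthonormal basis of the range of the projection
\<open>Q = I - X X\<^sup>\<dagger>\<close>, that is, of the orthogonal complement of the columns of \<open>X\<close>.
The resulting matrix satisfies both unitarity equations, and these force the number of
added columns to be \<open>m - k\<close>.\<close>

lemma orthonormal_completion:
  assumes X: "X \<in> carrier_mat m k" and XX: "X\<^sup>\<dagger> * X = 1\<^sub>m k"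
  obtains X2 where "k \<le> m" "X2 \<in> carrier_mat m (m - k)"
    "X\<^sup>\<dagger> * X2 = 0\<^sub>m k (m - k)" "X * X\<^sup>\<dagger> + X2 * X2\<^sup>\<dagger> = 1\<^sub>m m"
    "unitary_mat (hcat X X2)"
proof -
  define Q where "Q = 1\<^sub>m m - X * X\<^sup>\<dagger>"
  have Q: "Q \<in> carrier_mat m m" unfolding Q_def using X by auto
  have QX: "Q * X = 0\<^sub>m m k"
  proof -
    have "Q * X = 1\<^sub>m m * X - X * X\<^sup>\<dagger> * X"
      unfolding Q_def using X by (intro minus_mult_distrib_mat) auto
    also have "\<dots> = X - X" using X XX by (simp add: mat_mult_assoc)
    also have "\<dots> = 0\<^sub>m m k" using X by (intro eq_matI) auto
    finally show ?thesis .
  qed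
  have Qadj: "Q\<^sup>\<dagger> = Q" unfolding Q_def using X by (simp add: adjoint_minus adjoint_mult)
  obtain l Z Y where Z: "Z \<in> carrier_mat m l" and Y: "Y \<in> carrier_mat m l"
    and ZZ: "Z\<^sup>\<dagger> * Z = 1\<^sub>m l" and ZQ: "Z = Q * Y" and ZZQ: "Z * (Z\<^sup>\<dagger> * Q) = Q"
    using orthonormal_columns_spanning_range[OF Q] .
  have ZX: "Z\<^sup>\<dagger> * X = 0\<^sub>m l k"
    unfolding ZQ using Q Y X QX by (simp add: adjoint_mult Qadj mat_mult_assoc)
  have XZ: "X\<^sup>\<dagger> * Z = 0\<^sub>m k l"
    using arg_cong[OF ZX, of mat_adjoint] X Z by (simp add: adjoint_mult)
  have "Z\<^sup>\<dagger> * Q = Z\<^sup>\<dagger> * 1\<^sub>m m - Z\<^sup>\<dagger> * (X * X\<^sup>\<dagger>)"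
    unfolding Q_def using X Z by (intro mult_minus_distrib_mat) auto
  also have "Z\<^sup>\<dagger> * (X * X\<^sup>\<dagger>) = 0\<^sub>m l m"
    using X Z ZX by (simp flip: mat_mult_assoc)
  also have "Z\<^sup>\<dagger> * 1\<^sub>m m - 0\<^sub>m l m = Z\<^sup>\<dagger>" using Z by (intro eq_matI) auto
  finally have "Z * Z\<^sup>\<dagger> = Q" using ZZQ by simp
  then have sum: "X * X\<^sup>\<dagger> + Z * Z\<^sup>\<dagger> = 1\<^sub>m m"
    unfolding Q_def using X by (intro eq_matI) auto
  have H: "hcat X Z \<in> carrier_mat m (k + l)" using X Z by simp
  have HH: "(hcat X Z)\<^sup>\<dagger> * hcat X Z = 1\<^sub>m (k + l)"
    using X Z XX ZZ XZ ZX by (simp add: adjoint_hcat_mult_hcat[of _ m k _ l _ k _ l])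
  have HH': "hcat X Z * (hcat X Z)\<^sup>\<dagger> = 1\<^sub>m m"
    using X Z sum by (simp add: hcat_mult_adjoint_hcat[of _ m k _ l _ m])
  have "k + l = m"
    using right_inverse_imp_dim_le[OF H _ HH'] right_inverse_imp_dim_le[OF _ H HH] H by force
  then have l: "l = m - k" "k \<le> m" by auto
  have "unitary_mat (hcat X Z)"
    unfolding unitary_mat_def using H HH HH' \<open>k + l = m\<close> by auto
  then show ?thesis using that[of Z] l Z XZ sum by simp
qed

section \<open>T-EP matrices as products of an EP matrix and T\<close>

text \<open>Here \<open>E = A T\<^sup>\<dagger>\<close>. Since the range of \<open>A\<close> lies in that of \<open>T\<close>, the projection
\<open>T T\<^sup>\<dagger>\<close> fixes \<open>A\<close>. Multiplication by \<open>T\<close> or \<open>T\<^sup>\<dagger>\<close> on the right then changes neither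
the range of \<open>A\<close> nor that of \<open>T A\<^sup>\<dagger> = E\<^sup>\<dagger>\<close>, so the ranges of \<open>E\<close> and \<open>E\<^sup>\<dagger>\<close>
are those of \<open>A\<close> and \<open>T A\<^sup>\<dagger> T\<close>.\<close>

lemma T_EP_imp_EP_factor:
  assumes T: "T \<in> carrier_mat m n" and A: "A \<in> carrier_mat m n" and TEP: "T_EP T A"
  shows "EP_mat (A * T\<^sup>\<dagger>) \<and> A = A * T\<^sup>\<dagger> * T \<and> T * T\<^sup>\<dagger> * (A * T\<^sup>\<dagger>) = A * T\<^sup>\<dagger>"
proof -
  have PI: "T * (T\<^sup>\<dagger> * T) = T" and ATT: "A * (T\<^sup>\<dagger> * T) = A"
    and rng: "mat_range A = mat_range (T * A\<^sup>\<dagger> * T)"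
    using TEP T A unfolding T_EP_def partial_isometry_def by (simp_all add: mat_mult_assoc)
  have B: "T * A\<^sup>\<dagger> * T \<in> carrier_mat m n"
    by (intro mult_carrier_mat[of _ m m] mult_carrier_mat[of _ m n]) (use T A in simp_all)
  obtain Y where Y: "Y \<in> carrier_mat n n" "A = T * A\<^sup>\<dagger> * T * Y"
    using factor_of_range_subset[OF A B] rng by blast
  obtain Z where Z: "Z \<in> carrier_mat n n" "T * A\<^sup>\<dagger> * T = A * Z"
    using factor_of_range_subset[OF B A] rng by blast
  have TTT: "T * (T\<^sup>\<dagger> * (T * M)) = T * M" if "M \<in> carrier_mat n q" for M :: "complex mat" and q
    using arg_cong[OF PI, of "\<lambda>S. S * M"] T that by (simp add: mat_mult_assoc)
  have TTA: "T * (T\<^sup>\<dagger> * A) = A"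
  proof -
    have "T * (T\<^sup>\<dagger> * A) = T * (T\<^sup>\<dagger> * (T * (A\<^sup>\<dagger> * (T * Y))))"
      using T A Y(1) by (subst Y(2)) (simp add: mat_mult_assoc)
    also have "\<dots> = T * (A\<^sup>\<dagger> * (T * Y))"
      using T A Y(1) by (intro TTT[of _ n]) auto
    also have "\<dots> = A" using T A Y by (simp add: mat_mult_assoc)
    finally show ?thesis .
  qed
  have ATT': "A\<^sup>\<dagger> * (T * T\<^sup>\<dagger>) = A\<^sup>\<dagger>"
    using arg_cong[OF TTA, of mat_adjoint] T A by (simp add: adjoint_mult mat_mult_assoc)
  have adjE: "(A * T\<^sup>\<dagger>)\<^sup>\<dagger> = T * A\<^sup>\<dagger>" using T A by (simp add: adjoint_mult)
  have "mat_range (A * T\<^sup>\<dagger>) = mat_range A"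
    by (rule range_eqI[of _ m m _ n "T\<^sup>\<dagger>" T]) (use T A ATT in \<open>auto simp: mat_mult_assoc\<close>)
  also note rng
  also have "mat_range (T * A\<^sup>\<dagger> * T) = mat_range (T * A\<^sup>\<dagger>)"
    by (rule range_eqI[of _ m n _ m T "T\<^sup>\<dagger>"]) (use T A ATT' in \<open>auto simp: mat_mult_assoc\<close>)
  finally have "EP_mat (A * T\<^sup>\<dagger>)"
    unfolding EP_mat_def adjE using T A by simp
  moreover have "A * T\<^sup>\<dagger> * T = A" using T A ATT by (simp add: mat_mult_assoc)
  moreover have "T * T\<^sup>\<dagger> * (A * T\<^sup>\<dagger>) = (T * (T\<^sup>\<dagger> * A)) * T\<^sup>\<dagger>"
    using T A by (simp add: mat_mult_assoc)
  ultimately show ?thesis unfolding TTA by simp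
qed

text \<open>Because \<open>E\<close> is EP, the projection \<open>T T\<^sup>\<dagger>\<close> fixes not only \<open>E\<close> but also \<open>E\<^sup>\<dagger>\<close>, hence
\<open>E T T\<^sup>\<dagger> = E\<close> and \<open>T (E T)\<^sup>\<dagger> T = E\<^sup>\<dagger> T\<close>. The ranges of \<open>E T\<close> and \<open>E\<^sup>\<dagger> T\<close> are
therefore those of \<open>E\<close> and \<open>E\<^sup>\<dagger>\<close>. The equality of ranges in the conclusion transfers the
rank from \<open>E T\<close> to \<open>E\<close>.\<close>

lemma EP_factor_imp_T_EP:
  assumes T: "T \<in> carrier_mat m n" and pi: "partial_isometry T"
    and E: "E \<in> carrier_mat m m" and EP: "EP_mat E" and TTE: "T * T\<^sup>\<dagger> * E = E"
  shows "T_EP T (E * T) \<and> mat_range (E * T) = mat_range E"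
proof -
  have PI: "T * (T\<^sup>\<dagger> * T) = T" using pi T by (simp add: partial_isometry_def mat_mult_assoc)
  have TTE': "T * (T\<^sup>\<dagger> * E) = E" using TTE T E by (simp add: mat_mult_assoc)
  have EaTT: "E\<^sup>\<dagger> * (T * T\<^sup>\<dagger>) = E\<^sup>\<dagger>"
    using arg_cong[OF TTE', of mat_adjoint] T E by (simp add: adjoint_mult mat_mult_assoc)
  have rng: "mat_range E = mat_range (E\<^sup>\<dagger>)" using EP by (simp add: EP_mat_def)
  obtain Y where Y: "Y \<in> carrier_mat m m" "E\<^sup>\<dagger> = E * Y"
    using factor_of_range_subset[of "E\<^sup>\<dagger>" m m E m] E rng by auto
  have "T * (T\<^sup>\<dagger> * E\<^sup>\<dagger>) = (T * (T\<^sup>\<dagger> * E)) * Y"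
    using T E Y by (simp add: mat_mult_assoc)
  then have TTEa: "T * (T\<^sup>\<dagger> * E\<^sup>\<dagger>) = E\<^sup>\<dagger>" using TTE' Y by simp
  have ETT: "E * (T * T\<^sup>\<dagger>) = E"
    using arg_cong[OF TTEa, of mat_adjoint] T E by (simp add: adjoint_mult mat_mult_assoc)
  have rET: "mat_range (E * T) = mat_range E"
    by (rule range_eqI[of _ m n _ m T "T\<^sup>\<dagger>"]) (use T E ETT in \<open>auto simp: mat_mult_assoc\<close>)
  have "T * (E * T)\<^sup>\<dagger> * T = T * (T\<^sup>\<dagger> * E\<^sup>\<dagger>) * T"
    using T E by (simp add: adjoint_mult)
  then have "T * (E * T)\<^sup>\<dagger> * T = E\<^sup>\<dagger> * T" unfolding TTEa .
  moreover have "mat_range (E\<^sup>\<dagger> * T) = mat_range (E\<^sup>\<dagger>)"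
    by (rule range_eqI[of _ m n _ m T "T\<^sup>\<dagger>"]) (use T E EaTT in \<open>auto simp: mat_mult_assoc\<close>)
  ultimately have "mat_range (E * T) = mat_range (T * (E * T)\<^sup>\<dagger> * T)"
    using rET rng by simp
  moreover have "E * T * T\<^sup>\<dagger> * T = E * T" using T E PI by (simp add: mat_mult_assoc)
  ultimately show ?thesis using pi T E rET by (simp add: T_EP_def)
qed

section \<open>Simultaneous block forms\<close>

text \<open>The map \<open>cj\<close>, which takes \<open>M\<close> to \<open>U diag(M, 0) U\<^sup>\<dagger>\<close>, respects products and adjoints.
So \<open>D = D\<^sup>\<dagger> (D'\<^sup>\<dagger> D)\<close> and \<open>D\<^sup>\<dagger> = D (D' D\<^sup>\<dagger>)\<close>, with \<open>D'\<close> the inverse of \<open>D\<close>,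
carry over to the images and show that each range contains the other.\<close>

lemma unitary_block_EP:
  assumes D: "D \<in> carrier_mat r r" and inv: "invertible_mat D"
    and U: "U \<in> carrier_mat (r + s) (r + s)" and un: "unitary_mat U"
  shows "EP_mat (U * four_block_mat D (0\<^sub>m r s) (0\<^sub>m s r) (0\<^sub>m s s) * U\<^sup>\<dagger>)"
proof -
  define blk where "blk M = four_block_mat M (0\<^sub>m r s) (0\<^sub>m s r) (0\<^sub>m s s)" for M :: "complex mat"
  define cj where "cj M = U * blk M * U\<^sup>\<dagger>" for M
  have blk: "blk M \<in> carrier_mat (r + s) (r + s)" if "M \<in> carrier_mat r r" for M
    unfolding blk_def using that by simp
  have cj: "cj M \<in> carrier_mat (r + s) (r + s)" if "M \<in> carrier_mat r r" for M
    unfolding cj_def using blk[OF that] U by (intro mult_carrier_mat[of _ _ "r + s"]) simp_all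
  have UU: "U\<^sup>\<dagger> * U = 1\<^sub>m (r + s)" using un U by (auto simp: unitary_mat_def)
  have cj_mult: "cj M * cj N = cj (M * N)" if M: "M \<in> carrier_mat r r" and N: "N \<in> carrier_mat r r" for M N
  proof -
    have "cj M * cj N = U * (blk M * ((U\<^sup>\<dagger> * U) * (blk N * U\<^sup>\<dagger>)))"
      unfolding cj_def using blk[OF M] blk[OF N] U by (simp add: mat_mult_assoc)
    also have "\<dots> = U * (blk M * blk N) * U\<^sup>\<dagger>"
      unfolding UU using blk[OF M] blk[OF N] U by (simp add: mat_mult_assoc)
    also have "blk M * blk N = blk (M * N)"
      unfolding blk_def using M N by (subst mult_four_block_mat) auto
    finally show ?thesis by (simp add: cj_def)
  qed
  have cj_adj: "(cj M)\<^sup>\<dagger> = cj (M\<^sup>\<dagger>)" if M: "M \<in> carrier_mat r r" for M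
  proof -
    have "(blk M)\<^sup>\<dagger> = blk (M\<^sup>\<dagger>)"
      unfolding blk_def using M by (subst adjoint_four_block) auto
    then show ?thesis unfolding cj_def using blk[OF M] U by (simp add: adjoint_mult mat_mult_assoc)
  qed
  obtain D' where D': "D' \<in> carrier_mat r r" and DD': "D * D' = 1\<^sub>m r"
  proof -
    obtain B where B: "D * B = 1\<^sub>m r" "B * D = 1\<^sub>m (dim_row B)"
      using inv D by (auto simp: invertible_mat_def inverts_mat_def)
    have "dim_col B = r" using arg_cong[OF B(1), of dim_col] by simp
    moreover have "dim_row B = r" using arg_cong[OF B(2), of dim_col] D by simp
    ultimately show ?thesis using that B(1) by blast
  qed
  have D'D: "D' * D = 1\<^sub>m r" using mat_mult_left_right_inverse[OF D D' DD'] .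
  have adj: "D\<^sup>\<dagger> * D'\<^sup>\<dagger> = 1\<^sub>m r"
    using arg_cong[OF D'D, of mat_adjoint] D D' by (simp add: adjoint_mult)
  have "mat_range (cj D) = mat_range (cj (D\<^sup>\<dagger>))"
  proof (rule range_eqI[of _ "r + s" "r + s" _ "r + s" "cj (D'\<^sup>\<dagger> * D)" "cj (D' * D\<^sup>\<dagger>)"])
    show "cj D = cj (D\<^sup>\<dagger>) * cj (D'\<^sup>\<dagger> * D)"
      using D D' adj by (subst cj_mult) (auto simp flip: mat_mult_assoc)
    show "cj (D\<^sup>\<dagger>) = cj D * cj (D' * D\<^sup>\<dagger>)"
      using D D' DD' by (subst cj_mult) (auto simp flip: mat_mult_assoc)
  qed (use D D' in \<open>auto intro!: cj mult_carrier_mat[of _ r r]\<close>)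
  then have "EP_mat (cj D)" unfolding EP_mat_def cj_adj[OF D] using cj[OF D] by simp
  then show ?thesis by (simp add: cj_def blk_def)
qed

text \<open>In the coordinates given by \<open>U\<close>, the matrix \<open>T T\<^sup>\<dagger>\<close> is \<open>diag(I, T4 T4\<^sup>\<dagger>)\<close> and \<open>E\<close>
is \<open>diag(D, 0)\<close>.\<close>

lemma block_range_fixed:
  assumes D: "D \<in> carrier_mat r r"
    and U: "U \<in> carrier_mat (r + s) (r + s)" and unU: "unitary_mat U"
    and V: "V \<in> carrier_mat (r + t) (r + t)" and unV: "unitary_mat V"
    and T1: "T1 \<in> carrier_mat r r" and T4: "T4 \<in> carrier_mat s t" and T11: "T1 * T1\<^sup>\<dagger> = 1\<^sub>m r"
    and T: "T = U * four_block_mat T1 (0\<^sub>m r t) (0\<^sub>m s r) T4 * V\<^sup>\<dagger>"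
    and E: "E = U * four_block_mat D (0\<^sub>m r s) (0\<^sub>m s r) (0\<^sub>m s s) * U\<^sup>\<dagger>"
  shows "T * T\<^sup>\<dagger> * E = E"
proof -
  define S where "S = four_block_mat T1 (0\<^sub>m r t) (0\<^sub>m s r) T4"
  define B where "B = four_block_mat D (0\<^sub>m r s) (0\<^sub>m s r) (0\<^sub>m s s)"
  have S: "S \<in> carrier_mat (r + s) (r + t)" unfolding S_def using T1 T4 by simp
  have B: "B \<in> carrier_mat (r + s) (r + s)" unfolding B_def using D by simp
  have UU: "U\<^sup>\<dagger> * U = 1\<^sub>m (r + s)" using unU U by (auto simp: unitary_mat_def)
  have VV: "V\<^sup>\<dagger> * V = 1\<^sub>m (r + t)" using unV V by (auto simp: unitary_mat_def)
  have "T * T\<^sup>\<dagger> * E = U * (S * ((V\<^sup>\<dagger> * V) * (S\<^sup>\<dagger> * ((U\<^sup>\<dagger> * U) * (B * U\<^sup>\<dagger>)))))"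
    unfolding T E S_def[symmetric] B_def[symmetric] using S B U V
    by (simp add: mat_mult_assoc adjoint_mult)
  also have "\<dots> = U * ((S * S\<^sup>\<dagger>) * B) * U\<^sup>\<dagger>"
    unfolding UU VV using S B U V by (simp add: mat_mult_assoc)
  also have "S * S\<^sup>\<dagger> = four_block_mat (1\<^sub>m r) (0\<^sub>m r s) (0\<^sub>m s r) (T4 * T4\<^sup>\<dagger>)"
    unfolding S_def adjoint_four_block[OF T1 zero_carrier_mat zero_carrier_mat T4] using T1 T4 T11
    by (subst mult_four_block_mat[of _ r r _ t _ s _ _ r _ s]) auto
  also have "\<dots> * B = B"
    unfolding B_def using D T4 by (subst mult_four_block_mat[of _ r r _ s _ s _ _ r _ s]) auto
  finally show ?thesis by (simp add: E B_def)
qed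

text \<open>Let the columns of \<open>X\<close> be an orthonormal basis of the common range of \<open>E\<close> and \<open>E\<^sup>\<dagger>\<close>.
They lie in the range of \<open>T\<close>, on which \<open>T\<^sup>\<dagger>\<close> is isometric, so the columns of
\<open>W = T\<^sup>\<dagger> X\<close> are orthonormal too. Complete both to unitary matrices \<open>U = [X X2]\<close> and
\<open>V = [W W2]\<close>. As \<open>E = X X\<^sup>\<dagger> E X X\<^sup>\<dagger>\<close>, only the upper left block of \<open>E\<close> survives in
the coordinates \<open>U\<close>. And \<open>T W = X\<close>, \<open>T\<^sup>\<dagger> X = W\<close> say that \<open>T\<close> maps the span of \<open>W\<close> onto that of
\<open>X\<close> and the complement of the first into the complement of the second, which makes \<open>T\<close> block
diagonal, with upper left block the identity. The lower right block inherits the partial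
isometry equation from \<open>T\<close>.\<close>

lemma EP_factor_imp_block_form:
  assumes T: "T \<in> carrier_mat m n" and pi: "partial_isometry T"
    and E: "E \<in> carrier_mat m m" and EP: "EP_mat E" and TTE: "T * T\<^sup>\<dagger> * E = E"
    and rk: "mat_rank E = r"
  shows "\<exists>D U V T4. D \<in> carrier_mat r r \<and> invertible_mat D \<and>
    U \<in> carrier_mat m m \<and> unitary_mat U \<and> V \<in> carrier_mat n n \<and> unitary_mat V \<and>
    T4 \<in> carrier_mat (m - r) (n - r) \<and> T4 * T4\<^sup>\<dagger> * T4 = T4 \<and>
    E = U * four_block_mat D (0\<^sub>m r (m - r)) (0\<^sub>m (m - r) r) (0\<^sub>m (m - r) (m - r)) * U\<^sup>\<dagger> \<and>
    T = U * four_block_mat (1\<^sub>m r) (0\<^sub>m r (n - r)) (0\<^sub>m (m - r) r) T4 * V\<^sup>\<dagger>"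
proof -
  have PI: "T * (T\<^sup>\<dagger> * T) = T" using pi T by (simp add: partial_isometry_def mat_mult_assoc)
  have TTE': "T * (T\<^sup>\<dagger> * E) = E" using TTE T E by (simp add: mat_mult_assoc)
  obtain X Y where X: "X \<in> carrier_mat m r" and Y: "Y \<in> carrier_mat m r"
    and XX: "X\<^sup>\<dagger> * X = 1\<^sub>m r" and XEY: "X = E * Y" and XXE: "X * (X\<^sup>\<dagger> * E) = E"
    using orthonormal_range_basis[OF E] unfolding rk .
  obtain Z where Z: "Z \<in> carrier_mat m m" "E\<^sup>\<dagger> = E * Z"
    using factor_of_range_subset[of "E\<^sup>\<dagger>" m m E m] E EP by (auto simp: EP_mat_def)
  have "X * (X\<^sup>\<dagger> * E\<^sup>\<dagger>) = (X * (X\<^sup>\<dagger> * E)) * Z"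
    using X E Z by (simp add: mat_mult_assoc)
  then have XXEa: "X * (X\<^sup>\<dagger> * E\<^sup>\<dagger>) = E\<^sup>\<dagger>" using XXE Z by simp
  have EXX: "E * (X * X\<^sup>\<dagger>) = E"
    using arg_cong[OF XXEa, of mat_adjoint] X E by (simp add: adjoint_mult mat_mult_assoc)
  define D where "D = X\<^sup>\<dagger> * E * X"
  have D: "D \<in> carrier_mat r r"
    unfolding D_def using X E by (intro mult_carrier_mat[of _ _ m]) simp_all
  have XDX: "X * D * X\<^sup>\<dagger> = E"
  proof -
    have "X * D * X\<^sup>\<dagger> = (X * (X\<^sup>\<dagger> * E)) * (X * X\<^sup>\<dagger>)"
      unfolding D_def using X E by (simp add: mat_mult_assoc)
    then show ?thesis using XXE EXX by simp
  qed
  have "invertible_mat D"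
  proof -
    \<comment> \<open>\<open>X = E Y\<close> says that \<open>Y\<close> inverts \<open>E\<close> on its range.\<close>
    define B where "B = X\<^sup>\<dagger> * Y"
    have B: "B \<in> carrier_mat r r"
      unfolding B_def using X Y by (intro mult_carrier_mat[of _ _ m]) simp_all
    have "D * B = X\<^sup>\<dagger> * ((E * (X * X\<^sup>\<dagger>)) * Y)"
      unfolding D_def B_def using X E Y by (simp add: mat_mult_assoc)
    also have "\<dots> = 1\<^sub>m r" unfolding EXX using XEY XX by simp
    finally have DB: "D * B = 1\<^sub>m r" .
    then have "B * D = 1\<^sub>m r" using mat_mult_left_right_inverse[OF D B] by blast
    with DB show ?thesis using D B by (auto simp: invertible_mat_def inverts_mat_def)
  qed
  have TTX: "T * (T\<^sup>\<dagger> * X) = X"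
  proof -
    have "T * (T\<^sup>\<dagger> * X) = (T * (T\<^sup>\<dagger> * E)) * Y" unfolding XEY using T E Y by (simp add: mat_mult_assoc)
    then show ?thesis using TTE' XEY by simp
  qed
  have XTT: "X\<^sup>\<dagger> * (T * T\<^sup>\<dagger>) = X\<^sup>\<dagger>"
    using arg_cong[OF TTX, of mat_adjoint] X T by (simp add: adjoint_mult mat_mult_assoc)
  define W where "W = T\<^sup>\<dagger> * X"
  have W: "W \<in> carrier_mat n r" unfolding W_def using T X by (intro mult_carrier_mat[of _ _ m]) simp_all
  have Wa: "W\<^sup>\<dagger> = X\<^sup>\<dagger> * T" unfolding W_def using T X by (simp add: adjoint_mult)
  have TW: "T * W = X" using TTX by (simp add: W_def)
  have WW: "W\<^sup>\<dagger> * W = 1\<^sub>m r"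
    unfolding Wa using T X W TW XX by (simp add: mat_mult_assoc)
  obtain X2 where rm: "r \<le> m" and X2: "X2 \<in> carrier_mat m (m - r)"
    and XX2: "X\<^sup>\<dagger> * X2 = 0\<^sub>m r (m - r)"
    and sumX: "X * X\<^sup>\<dagger> + X2 * X2\<^sup>\<dagger> = 1\<^sub>m m" and unU: "unitary_mat (hcat X X2)"
    using orthonormal_completion[OF X XX] .
  obtain W2 where rn: "r \<le> n" and W2: "W2 \<in> carrier_mat n (n - r)"
    and WW2: "W\<^sup>\<dagger> * W2 = 0\<^sub>m r (n - r)"
    and sumW: "W * W\<^sup>\<dagger> + W2 * W2\<^sup>\<dagger> = 1\<^sub>m n" and unV: "unitary_mat (hcat W W2)"
    using orthonormal_completion[OF W WW] .
  define T4 where "T4 = X2\<^sup>\<dagger> * T * W2"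
  have T4: "T4 \<in> carrier_mat (m - r) (n - r)"
    unfolding T4_def using X2 T W2
    by (intro mult_carrier_mat[of _ _ n] mult_carrier_mat[of _ _ m]) simp_all
  have splitX: "X * (X\<^sup>\<dagger> * M) + X2 * (X2\<^sup>\<dagger> * M) = M" if M: "M \<in> carrier_mat m q" for M q
  proof -
    have "(X * X\<^sup>\<dagger> + X2 * X2\<^sup>\<dagger>) * M = X * X\<^sup>\<dagger> * M + X2 * X2\<^sup>\<dagger> * M"
      using X X2 M by (intro add_mult_distrib_mat) auto
    then show ?thesis unfolding sumX using X X2 M by (simp add: mat_mult_assoc)
  qed
  have splitW: "W * (W\<^sup>\<dagger> * M) + W2 * (W2\<^sup>\<dagger> * M) = M" if M: "M \<in> carrier_mat n q" for M q
  proof -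
    have "(W * W\<^sup>\<dagger> + W2 * W2\<^sup>\<dagger>) * M = W * W\<^sup>\<dagger> * M + W2 * W2\<^sup>\<dagger> * M"
      using W W2 M by (intro add_mult_distrib_mat) auto
    then show ?thesis unfolding sumW using W W2 M by (simp add: mat_mult_assoc)
  qed
  have X2TW2: "X2 * T4 = T * W2"
  proof -
    have "X\<^sup>\<dagger> * (T * W2) = 0\<^sub>m r (n - r)"
      using WW2 X T W2 by (simp add: Wa mat_mult_assoc)
    moreover have "X2 * (X2\<^sup>\<dagger> * (T * W2)) \<in> carrier_mat m (n - r)"
      by (rule carrier_matI) (use X2 W2 in simp_all)
    ultimately have "X2 * (X2\<^sup>\<dagger> * (T * W2)) = T * W2"
      using splitX[of "T * W2" "n - r"] X T W2 by simp
    then show ?thesis using X2 T W2 by (simp add: T4_def mat_mult_assoc)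
  qed
  have TX2: "W2 * (W2\<^sup>\<dagger> * (T\<^sup>\<dagger> * X2)) = T\<^sup>\<dagger> * X2"
  proof -
    have "W\<^sup>\<dagger> * (T\<^sup>\<dagger> * X2) = (X\<^sup>\<dagger> * (T * T\<^sup>\<dagger>)) * X2"
      unfolding Wa using X T X2 by (simp add: mat_mult_assoc)
    then have "W\<^sup>\<dagger> * (T\<^sup>\<dagger> * X2) = 0\<^sub>m r (m - r)" unfolding XTT XX2 .
    moreover have "W2 * (W2\<^sup>\<dagger> * (T\<^sup>\<dagger> * X2)) \<in> carrier_mat n (m - r)"
      by (rule carrier_matI) (use W2 X2 in simp_all)
    ultimately show ?thesis
      using splitW[of "T\<^sup>\<dagger> * X2" "m - r"] W T X2 by (simp add: mult_carrier_mat[of _ n m])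
  qed
  have T4a: "W2 * T4\<^sup>\<dagger> = T\<^sup>\<dagger> * X2"
    using TX2 X2 T W2 by (simp add: T4_def adjoint_mult mat_mult_assoc)
  have T4a': "T4 * W2\<^sup>\<dagger> = X2\<^sup>\<dagger> * T"
    using arg_cong[OF T4a, of mat_adjoint] T4 X2 T W2 by (simp add: adjoint_mult)
  have T4pi: "T4 * T4\<^sup>\<dagger> * T4 = T4"
  proof -
    have "T4 * T4\<^sup>\<dagger> * T4 = X2\<^sup>\<dagger> * T * W2 * T4\<^sup>\<dagger> * T4"
      by (simp add: T4_def)
    also have "\<dots> = X2\<^sup>\<dagger> * (T * ((W2 * T4\<^sup>\<dagger>) * T4))"
      using X2 T W2 T4 by (simp add: mat_mult_assoc)
    also have "\<dots> = X2\<^sup>\<dagger> * (T * (T\<^sup>\<dagger> * (X2 * T4)))"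
      unfolding T4a using X2 T T4 by (simp add: mat_mult_assoc)
    also have "\<dots> = X2\<^sup>\<dagger> * ((T * (T\<^sup>\<dagger> * T)) * W2)"
      unfolding X2TW2 using X2 T W2 by (simp add: mat_mult_assoc)
    also have "\<dots> = T4" unfolding PI T4_def using X2 T W2 by (simp add: mat_mult_assoc)
    finally show ?thesis .
  qed
  define U where "U = hcat X X2"
  define V where "V = hcat W W2"
  have U: "U \<in> carrier_mat m m" using hcat_carrier[OF X X2] rm by (simp add: U_def)
  have V: "V \<in> carrier_mat n n" using hcat_carrier[OF W W2] rn by (simp add: V_def)
  have Eeq: "E = U * four_block_mat D (0\<^sub>m r (m - r)) (0\<^sub>m (m - r) r) (0\<^sub>m (m - r) (m - r)) * U\<^sup>\<dagger>"
  proof -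
    have "U * four_block_mat D (0\<^sub>m r (m - r)) (0\<^sub>m (m - r) r) (0\<^sub>m (m - r) (m - r))
        = hcat (X * D) (0\<^sub>m m (m - r))"
      unfolding U_def using X X2 D
      by (subst hcat_mult_four_block[of _ m r _ "m - r" _ r _ "m - r"]) auto
    also have "\<dots> * U\<^sup>\<dagger> = X * D * X\<^sup>\<dagger>"
      unfolding U_def using X X2 D
      by (subst hcat_mult_adjoint_hcat[of _ m r _ "m - r" _ m]) auto
    finally show ?thesis using XDX by simp
  qed
  have Teq: "T = U * four_block_mat (1\<^sub>m r) (0\<^sub>m r (n - r)) (0\<^sub>m (m - r) r) T4 * V\<^sup>\<dagger>"
  proof -
    have "U * four_block_mat (1\<^sub>m r) (0\<^sub>m r (n - r)) (0\<^sub>m (m - r) r) T4 = hcat X (X2 * T4)"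
      unfolding U_def using X X2 T4
      by (subst hcat_mult_four_block[of _ m r _ "m - r" _ r _ "n - r"]) auto
    also have "\<dots> * V\<^sup>\<dagger> = X * W\<^sup>\<dagger> + X2 * T4 * W2\<^sup>\<dagger>"
      unfolding V_def using X X2 W W2 T4
      by (subst hcat_mult_adjoint_hcat[of _ m r _ "n - r" _ n]) auto
    also have "\<dots> = X * (X\<^sup>\<dagger> * T) + X2 * (X2\<^sup>\<dagger> * T)"
      unfolding Wa using X2 T4 W2 T4a' by (simp add: mat_mult_assoc)
    also have "\<dots> = T" by (rule splitX[OF T])
    finally show ?thesis by simp
  qed
  show ?thesis
    using D \<open>invertible_mat D\<close> U unU V unV T4 T4pi Eeq Teq unfolding U_def[symmetric] V_def[symmetric]
    by blast
qed

section \<open>The characterisations of T-EP matrices\<close>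

theorem theorem3p2:
  fixes T A :: "complex mat" and m n r :: nat
  assumes "T \<in> carrier_mat m n" and "partial_isometry T"
    and "A \<in> carrier_mat m n" and "mat_rank A = r"
  shows
    "(T_EP T A \<longleftrightarrow>
      (\<exists>D U V T1 T4.
        D \<in> carrier_mat r r \<and> invertible_mat D \<and>
        U \<in> carrier_mat m m \<and> unitary_mat U \<and>
        V \<in> carrier_mat n n \<and> unitary_mat V \<and>
        T1 \<in> carrier_mat r r \<and> T4 \<in> carrier_mat (m - r) (n - r) \<and>
        T1 * T1\<^sup>\<dagger> = 1\<^sub>m r \<and> T4 * T4\<^sup>\<dagger> * T4 = T4 \<and>
        A = U * four_block_mat D (0\<^sub>m r (m - r)) (0\<^sub>m (m - r) r) (0\<^sub>m (m - r) (m - r)) * U\<^sup>\<dagger> * T \<and>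
        T = U * four_block_mat T1 (0\<^sub>m r (n - r)) (0\<^sub>m (m - r) r) T4 * V\<^sup>\<dagger>)) \<and>
     (T_EP T A \<longleftrightarrow>
      (\<exists>E. E \<in> carrier_mat m m \<and> EP_mat E \<and> A = E * T \<and> T * T\<^sup>\<dagger> * E = E))"
    (is "(?i \<longleftrightarrow> ?ii) \<and> (?i \<longleftrightarrow> ?iii)")
proof -
  have i_iii: "?i \<Longrightarrow> ?iii"
    using T_EP_imp_EP_factor[OF assms(1,3)] assms(1,3)
    by (intro exI[of _ "A * T\<^sup>\<dagger>"]) auto
  have iii_i: "?iii \<Longrightarrow> ?i"
    using EP_factor_imp_T_EP[OF assms(1,2)] by blast
  have iii_ii: ?ii if iii: ?iii
  proof -
    from iii obtain E where E: "E \<in> carrier_mat m m" and EP: "EP_mat E" and AE: "A = E * T"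
      and TTE: "T * T\<^sup>\<dagger> * E = E" by blast
    have "mat_range (E * T) = mat_range E"
      using EP_factor_imp_T_EP[OF assms(1,2) E EP TTE] by blast
    then have "mat_rank A = mat_rank E" unfolding AE by (intro rank_cong_range) auto
    then have "mat_rank E = r" using assms(4) by simp
    from EP_factor_imp_block_form[OF assms(1,2) E EP TTE this] obtain D U V T4 where form:
      "D \<in> carrier_mat r r" "invertible_mat D" "U \<in> carrier_mat m m" "unitary_mat U"
      "V \<in> carrier_mat n n" "unitary_mat V" "T4 \<in> carrier_mat (m - r) (n - r)" "T4 * T4\<^sup>\<dagger> * T4 = T4"
      and E_form:
      "E = U * four_block_mat D (0\<^sub>m r (m - r)) (0\<^sub>m (m - r) r) (0\<^sub>m (m - r) (m - r)) * U\<^sup>\<dagger>"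
      and T_form: "T = U * four_block_mat (1\<^sub>m r) (0\<^sub>m r (n - r)) (0\<^sub>m (m - r) r) T4 * V\<^sup>\<dagger>"
      by blast
    have one: "(1\<^sub>m r :: complex mat) * (1\<^sub>m r)\<^sup>\<dagger> = 1\<^sub>m r" by simp
    show ?ii
      by (intro exI[of _ D] exI[of _ U] exI[of _ V] exI[of _ "1\<^sub>m r"] exI[of _ T4] conjI
          form one one_carrier_mat AE[unfolded E_form] T_form)
  qed
  \<comment> \<open>The differences \<open>m - r\<close> and \<open>n - r\<close> of natural numbers are genuine ones.\<close>
  have rm: "r \<le> m" using rank_le_dim_row[of A] assms(3,4) by simp
  have rn: "r \<le> n" using vec_space.rank_le_nc[OF assms(3)] assms(3,4) by simp
  have ii_iii: ?iii if ii: ?ii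
  proof -
    from ii obtain D U V T1 T4 where D: "D \<in> carrier_mat r r" "invertible_mat D"
      and U: "U \<in> carrier_mat m m" "unitary_mat U" and V: "V \<in> carrier_mat n n" "unitary_mat V"
      and T14: "T1 \<in> carrier_mat r r" "T4 \<in> carrier_mat (m - r) (n - r)" "T1 * T1\<^sup>\<dagger> = 1\<^sub>m r"
      and A: "A = U * four_block_mat D (0\<^sub>m r (m - r)) (0\<^sub>m (m - r) r) (0\<^sub>m (m - r) (m - r)) * U\<^sup>\<dagger> * T"
      and T: "T = U * four_block_mat T1 (0\<^sub>m r (n - r)) (0\<^sub>m (m - r) r) T4 * V\<^sup>\<dagger>"
      by blast
    define E where "E = U * four_block_mat D (0\<^sub>m r (m - r)) (0\<^sub>m (m - r) r) (0\<^sub>m (m - r) (m - r)) * U\<^sup>\<dagger>"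
    have U': "U \<in> carrier_mat (r + (m - r)) (r + (m - r))" using U rm by simp
    have V': "V \<in> carrier_mat (r + (n - r)) (r + (n - r))" using V rn by simp
    have "E \<in> carrier_mat m m" unfolding E_def by (rule carrier_matI) (use U in simp_all)
    moreover have "EP_mat E" unfolding E_def using unitary_block_EP[OF D U' U(2)] .
    moreover have "A = E * T" using A by (simp add: E_def)
    moreover have "T * T\<^sup>\<dagger> * E = E"
      using block_range_fixed[OF D(1) U' U(2) V' V(2) T14 T E_def] .
    ultimately show ?iii by blast
  qed
  show ?thesis using i_iii iii_i iii_ii ii_iii by blast
qed

end
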